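(* Let $G=(V,E)$ be an infinite, connected, simple graph properly embedded in $\mathbb{R}^2$ with minimal vertex degree at least $7$. For each $x\in V$, let $T_{2,x}$ be an infinite rooted binary tree embedded in $G$ (as a subgraph) with root $x$. Then for every $p\in(\tfrac12,1]$, \[ \lim_{N\to\infty}\ \inf_{x\in V}\ \inf_{T_{2,x,N}}\ \mathbb{P}_p\bigl(T_{2,x,N}\text{ intersects an infinite open cluster of }G\bigr)=1, \] where the second infimum is over all rooted binary trees $T_{2,x,N}\subseteq T_{2,x}$ of depth $N$ rooted at $x$.
   Context: A graph is properly embedded in $\mathbb{R}^2$ if it is drawn in the plane without edge crossings so that every compact subset of $\mathbb{R}^2$ intersects only finitely many vertices and edges. An infinite rooted binary tree is a rooted tree in which every vertex has exactly two children; a rooted binary tree of depth $N$ is its truncation to levels $0,\dots,N$ ($2^{N+1}-1$ vertices). $\mathbb{P}_p$ is the law of i.i.d. Bernoulli$(p)$ site percolation on $V$ (each vertex open with probability $p$); open clusters are connected components of the subgraph induced by open vertices. *)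

theory Defs
  imports "HOL-Probability.Probability"
begin

section \<open>Graphs\<close>

record 'a ugraph =
  verts :: "'a set"
  edges :: "'a set set"

definition simple_graph :: "'a ugraph \<Rightarrow> bool" where
  "simple_graph G \<longleftrightarrow>
     (\<forall>e\<in>edges G. \<exists>u\<in>verts G. \<exists>v\<in>verts G. u \<noteq> v \<and> e = {u, v})"

definition subgraph :: "'a ugraph \<Rightarrow> 'a ugraph \<Rightarrow> bool" where
  "subgraph H G \<longleftrightarrow> verts H \<subseteq> verts G \<and> edges H \<subseteq> edges G"

definition induced :: "'a ugraph \<Rightarrow> 'a set \<Rightarrow> 'a ugraph" where
  "induced G U =
     \<lparr>verts = verts G \<inter> U, edges = {e \<in> edges G. e \<subseteq> U}\<rparr>"

definition adj :: "'a ugraph \<Rightarrow> ('a \<times> 'a) set" where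
  "adj G = {(u, v). {u, v} \<in> edges G}"

definition connected_graph :: "'a ugraph \<Rightarrow> bool" where
  "connected_graph G \<longleftrightarrow>
     verts G \<noteq> {} \<and> (\<forall>u\<in>verts G. \<forall>v\<in>verts G. (u, v) \<in> (adj G)\<^sup>*)"

definition components :: "'a ugraph \<Rightarrow> 'a set set" where
  "components G = {{v \<in> verts G. (u, v) \<in> (adj G)\<^sup>*} | u. u \<in> verts G}"

text \<open>The cardinality of an infinite set is 0, so a lower bound on \<open>degree\<close> also asserts that the
  degree is finite. In a properly embedded graph all degrees are finite, so there this is no
  restriction.\<close>

definition degree :: "'a ugraph \<Rightarrow> 'a \<Rightarrow> nat" where
  "degree G v = card {e \<in> edges G. v \<in> e}"


section \<open>Proper embeddings in the plane\<close>

text \<open>The vertex \<open>v\<close> is drawn as the point \<open>pos v\<close>, the edge \<open>e\<close> as the closed arc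
  \<open>path_image (\<gamma> e)\<close> joining its end points. An arc passes through no vertex other than its end
  points, and two different arcs meet only in the common end points of the edges.\<close>

definition plane_drawing ::
    "'a ugraph \<Rightarrow> ('a \<Rightarrow> real^2) \<Rightarrow> ('a set \<Rightarrow> real \<Rightarrow> real^2) \<Rightarrow> bool" where
  "plane_drawing G pos \<gamma> \<longleftrightarrow>
     inj_on pos (verts G) \<and>
     (\<forall>e\<in>edges G. arc (\<gamma> e) \<and> {pathstart (\<gamma> e), pathfinish (\<gamma> e)} = pos ` e) \<and>
     (\<forall>e\<in>edges G. \<forall>v\<in>verts G. pos v \<in> path_image (\<gamma> e) \<longrightarrow> v \<in> e) \<and>
     (\<forall>e\<in>edges G. \<forall>f\<in>edges G. e \<noteq> f \<longrightarrow>
        path_image (\<gamma> e) \<inter> path_image (\<gamma> f) = pos ` (e \<inter> f))"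

definition properly_embedded ::
    "'a ugraph \<Rightarrow> ('a \<Rightarrow> real^2) \<Rightarrow> ('a set \<Rightarrow> real \<Rightarrow> real^2) \<Rightarrow> bool" where
  "properly_embedded G pos \<gamma> \<longleftrightarrow>
     plane_drawing G pos \<gamma> \<and>
     (\<forall>K. compact K \<longrightarrow>
        finite {v \<in> verts G. pos v \<in> K} \<and>
        finite {e \<in> edges G. path_image (\<gamma> e) \<inter> K \<noteq> {}})"


section \<open>Rooted binary trees\<close>

definition is_cycle :: "'a ugraph \<Rightarrow> 'a list \<Rightarrow> bool" where
  "is_cycle G c \<longleftrightarrow>
     3 \<le> length c \<and> distinct c \<and>
     (\<forall>i<length c. {c ! i, c ! (Suc i mod length c)} \<in> edges G)"

definition rooted_tree :: "'a ugraph \<Rightarrow> 'a \<Rightarrow> bool" where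
  "rooted_tree T r \<longleftrightarrow>
     simple_graph T \<and> connected_graph T \<and> (\<nexists>c. is_cycle T c) \<and> r \<in> verts T"

text \<open>The level of a vertex is its graph distance from the root.\<close>

definition level :: "'a ugraph \<Rightarrow> 'a \<Rightarrow> 'a \<Rightarrow> nat" where
  "level T r v = (LEAST n. (r, v) \<in> adj T ^^ n)"

definition children :: "'a ugraph \<Rightarrow> 'a \<Rightarrow> 'a \<Rightarrow> 'a set" where
  "children T r v = {w \<in> verts T. (v, w) \<in> adj T \<and> level T r w = Suc (level T r v)}"

definition infinite_binary_tree :: "'a ugraph \<Rightarrow> 'a \<Rightarrow> bool" where
  "infinite_binary_tree T r \<longleftrightarrow>
     rooted_tree T r \<and> (\<forall>v\<in>verts T. card (children T r v) = 2)"

definition binary_tree_of_depth :: "nat \<Rightarrow> 'a ugraph \<Rightarrow> 'a \<Rightarrow> bool" where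
  "binary_tree_of_depth N T r \<longleftrightarrow>
     rooted_tree T r \<and>
     (\<forall>v\<in>verts T. level T r v \<le> N \<and>
        (level T r v < N \<longrightarrow> card (children T r v) = 2))"


section \<open>Bernoulli site percolation\<close>

text \<open>A configuration \<open>\<omega>\<close> declares the vertex \<open>v\<close> open if \<open>\<omega> v\<close> holds.\<close>

definition percolation :: "'a ugraph \<Rightarrow> real \<Rightarrow> ('a \<Rightarrow> bool) measure" where
  "percolation G p = PiM (verts G) (\<lambda>_. measure_pmf (bernoulli_pmf p))"

definition open_clusters :: "'a ugraph \<Rightarrow> ('a \<Rightarrow> bool) \<Rightarrow> 'a set set" where
  "open_clusters G \<omega> = components (induced G {v. \<omega> v})"

definition meets_infinite_cluster :: "'a ugraph \<Rightarrow> 'a ugraph \<Rightarrow> ('a \<Rightarrow> bool) set" where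
  "meets_infinite_cluster G S =
     {\<omega>. \<exists>C\<in>open_clusters G \<omega>. infinite C \<and> verts S \<inter> C \<noteq> {}}"

end

theory Submission
  imports Defs
begin

text \<open>
  The infinite clusters can be found inside the given trees. Since a tree has unique parents, the
  \<open>2 ^ N\<close> vertices on level \<open>N\<close> of an infinite binary tree \<open>T\<close> are the roots of disjoint infinite
  binary trees, and each of them starts an infinite open descending path with the survival
  probability of a branching process whose mean offspring \<open>2 * p\<close> exceeds \<open>1\<close>. The extinction
  probability of this process is the smaller solution \<open>q = (1 - p) / p < 1\<close> of
  \<open>q = (1 - p) + p * q\<^sup>2\<close>. So the truncation of \<open>T\<close> to depth \<open>N\<close> misses all infinite clusters with
  probability at most \<open>q ^ (2 ^ N)\<close>, uniformly in the root.

  The extinction bound is proved for finite heights, by revealing one vertex at a time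
  (\<open>prob_all_descents_fail\<close>), and is then passed to the limit (\<open>prob_infinite_descent\<close>). On the side
  of graph theory, every binary tree of depth \<open>N\<close> inside \<open>T\<close> with the same root contains all of
  level \<open>N\<close> of \<open>T\<close> (\<open>binary_tree_of_depth_contains_levels\<close>), so the estimate applies to it, and
  the truncation of \<open>T\<close> is such a tree (\<open>binary_tree_of_depth_truncation\<close>), so the infimum ranges
  over a nonempty set. Properness of the embedding makes the vertex set countable, which makes the
  event measurable (\<open>meets_infinite_cluster_measurable\<close>).
\<close>

section \<open>Levels in rooted trees\<close>

lemma adj_iff: "(u, v) \<in> adj G \<longleftrightarrow> {u, v} \<in> edges G"
  by (simp add: adj_def)

lemma sym_adj: "sym (adj G)"
  by (auto simp: sym_def adj_def insert_commute)

lemma adj_verts: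
  assumes "simple_graph G" "(u, v) \<in> adj G"
  shows "u \<in> verts G" "v \<in> verts G"
  using assms by (fastforce simp: simple_graph_def adj_def doubleton_eq_iff)+

lemma level_le: "(r, v) \<in> adj T ^^ n \<Longrightarrow> level T r v \<le> n"
  unfolding level_def by (rule Least_le)

lemma level_root: "level T r r = 0"
  using level_le[of r r 0 T] by simp

lemma relpow_level:
  assumes "connected_graph T" "r \<in> verts T" "v \<in> verts T"
  shows "(r, v) \<in> adj T ^^ level T r v"
proof -
  have "\<exists>n. (r, v) \<in> adj T ^^ n"
    using assms by (auto simp: connected_graph_def rtrancl_power)
  then show ?thesis unfolding level_def by (rule LeastI_ex)
qed

lemma level_0_iff:
  assumes "connected_graph T" "r \<in> verts T" "v \<in> verts T"
  shows "level T r v = 0 \<longleftrightarrow> v = r"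
  using relpow_level[OF assms] by (auto simp: level_root)

lemma level_adj_le:
  assumes "connected_graph T" "r \<in> verts T" "v \<in> verts T" "(v, w) \<in> adj T"
  shows "level T r w \<le> Suc (level T r v)"
  using relpow_level[OF assms(1-3)] assms(4) by (intro level_le) auto

lemma parent_exists:
  assumes "simple_graph T" "connected_graph T" "r \<in> verts T" "w \<in> verts T" "level T r w = Suc n"
  shows "\<exists>v\<in>verts T. (v, w) \<in> adj T \<and> level T r v = n"
proof -
  have "(r, w) \<in> adj T ^^ Suc n" using relpow_level[OF assms(2-4)] assms(5) by simp
  then obtain v where v: "(r, v) \<in> adj T ^^ n" "(v, w) \<in> adj T" by auto
  have vT: "v \<in> verts T" using adj_verts[OF assms(1) v(2)] by simp
  have "level T r v = n"
    using level_le[OF v(1)] level_adj_le[OF assms(2,3) vT v(2)] assms(5) by simp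
  then show ?thesis using v vT by blast
qed

text \<open>Two different parents of one vertex would have ancestor lines that first meet at a common
  ancestor, at the latest in the root; the two lines up to that point close up to a cycle.\<close>

lemma parent_unique:
  assumes T: "rooted_tree T r"
    and u: "(u, w) \<in> adj T" "level T r u = n"
    and u': "(u', w) \<in> adj T" "level T r u' = n"
    and w: "level T r w = Suc n"
  shows "u = u'"
proof (rule ccontr)
  assume neq: "u \<noteq> u'"
  have sg: "simple_graph T" and con: "connected_graph T" and r: "r \<in> verts T"
    and acyc: "\<nexists>c. is_cycle T c"
    using T by (auto simp: rooted_tree_def)
  have "\<forall>v. \<exists>y. v \<in> verts T \<and> 0 < level T r v \<longrightarrow>
      y \<in> verts T \<and> (y, v) \<in> adj T \<and> Suc (level T r y) = level T r v"
    using parent_exists[OF sg con r] by (metis Suc_pred)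
  then obtain par where par: "\<And>v. v \<in> verts T \<Longrightarrow> 0 < level T r v \<Longrightarrow>
      par v \<in> verts T \<and> (par v, v) \<in> adj T \<and> Suc (level T r (par v)) = level T r v"
    by metis
  define anc where "anc y i = (par ^^ i) y" for y i
  have anc: "anc y i \<in> verts T \<and> level T r (anc y i) = n - i"
    if "y \<in> verts T" "level T r y = n" "i \<le> n" for y i
    using that(3)
  proof (induction i)
    case 0
    then show ?case using that by (simp add: anc_def)
  next
    case (Suc i)
    then show ?case using par[of "anc y i"] by (auto simp: anc_def)
  qed
  have anc_adj: "(anc y (Suc i), anc y i) \<in> adj T"
    if "y \<in> verts T" "level T r y = n" "i < n" for y i
    using anc[OF that(1,2), of i] that(3) par[of "anc y i"] by (auto simp: anc_def)
  have uT: "u \<in> verts T" and uT': "u' \<in> verts T" and wT: "w \<in> verts T"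
    using adj_verts[OF sg] u(1) u'(1) by auto
  define a where "a = anc u"
  define b where "b = anc u'"
  have lev_a: "level T r (a i) = n - i" and lev_b: "level T r (b i) = n - i" if "i \<le> n" for i
    using anc uT uT' u(2) u'(2) that by (auto simp: a_def b_def)
  have adj_a: "{a (Suc i), a i} \<in> edges T" and adj_b: "{b (Suc i), b i} \<in> edges T"
    if "i < n" for i
    using anc_adj uT uT' u(2) u'(2) that by (auto simp: a_def b_def adj_iff)
  have a0: "a 0 = u" and b0: "b 0 = u'" by (auto simp: a_def b_def anc_def)
  have "a n = r" "b n = r"
    using anc[OF uT u(2), of n] anc[OF uT' u'(2), of n] level_0_iff[OF con r]
    by (auto simp: a_def b_def)
  then have ab_n: "a n = b n" by simp
  define k where "k = (LEAST i. a i = b i)"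
  have ab_k: "a k = b k" unfolding k_def by (rule LeastI[of "\<lambda>i. a i = b i" n, OF ab_n])
  have kn: "k \<le> n" unfolding k_def by (rule Least_le[of "\<lambda>i. a i = b i" n, OF ab_n])
  have ab_neq: "a i \<noteq> b i" if "i < k" for i
    using not_less_Least[of i "\<lambda>i. a i = b i"] that by (simp add: k_def)
  have k0: "0 < k" using ab_k neq a0 b0 by (cases k) auto
  \<comment> \<open>The cycle: \<open>w\<close>, up the line of \<open>u\<close> to the common ancestor \<open>a k = b k\<close>, down the line of \<open>u'\<close>.\<close>
  define f where "f i = (if i = 0 then w else if i \<le> Suc k then a (i - 1) else b (2 * k + 1 - i))"
    for i
  define h where "h i = (if i = 0 then Suc n else if i \<le> Suc k then n - (i - 1)
      else n - (2 * k + 1 - i))" for i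
  have lev_f: "level T r (f i) = h i" if "i < 2 * k + 2" for i
    using that kn w lev_a lev_b by (auto simp: f_def h_def)
  have f_neq: "f i \<noteq> f j" if "i < j" "j < 2 * k + 2" for i j
  proof
    assume eq: "f i = f j"
    then have h: "h i = h j" using lev_f that by (metis less_trans)
    then have i: "0 < i" "i \<le> Suc k" "Suc k < j"
      using that kn by (auto simp: h_def split: if_splits)
    then have ij: "i - 1 = 2 * k + 1 - j" using h that kn by (auto simp: h_def split: if_splits)
    then have "i - 1 < k" using i that by linarith
    then show False using eq i ab_neq[of "i - 1"] ij by (auto simp: f_def)
  qed
  define c where "c = map f [0..<2 * k + 2]"
  have len: "length c = 2 * k + 2" by (simp add: c_def)
  have nth: "c ! i = f i" if "i < 2 * k + 2" for i
    using that unfolding c_def by (rule nth_map_upt[of _ _ 0, simplified])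
  have "distinct c"
    unfolding distinct_conv_nth len
  proof (intro allI impI)
    fix i j assume "i < 2 * k + 2" "j < 2 * k + 2" "i \<noteq> j"
    then show "c ! i \<noteq> c ! j"
      using f_neq[of i j] f_neq[of j i] by (cases "i < j") (auto simp: nth)
  qed
  moreover have "{c ! i, c ! (Suc i mod length c)} \<in> edges T" if i: "i < length c" for i
  proof -
    consider "i = 0" | "0 < i" "i \<le> k" | "i = Suc k" | "Suc k < i" "i < 2 * k + 1" | "i = 2 * k + 1"
      using i len by linarith
    then have "{f i, f (Suc i mod (2 * k + 2))} \<in> edges T"
    proof cases
      case 1
      then show ?thesis using u(1) a0 k0 by (simp add: f_def adj_iff insert_commute)
    next
      case 2
      then have "Suc i mod (2 * k + 2) = Suc i" by (intro mod_less) linarith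
      then show ?thesis using adj_a[of "i - 1"] 2 kn by (simp add: f_def insert_commute)
    next
      case 3
      then have "Suc i mod (2 * k + 2) = Suc i" using k0 by (intro mod_less) linarith
      moreover have "2 * k + 1 - Suc (Suc k) = k - 1" by simp
      ultimately show ?thesis using adj_b[of "k - 1"] 3 kn k0 ab_k by (simp add: f_def)
    next
      case 4
      then have "Suc i mod (2 * k + 2) = Suc i" by (intro mod_less) linarith
      moreover have "Suc (2 * k - i) = 2 * k + 1 - i" using 4 by linarith
      ultimately show ?thesis using adj_b[of "2 * k - i"] 4 kn by (simp add: f_def)
    next
      case 5
      then show ?thesis using u'(1) b0 k0 by (simp add: f_def adj_iff insert_commute)
    qed
    then show ?thesis using i by (simp add: nth len del: mult_Suc_right)
  qed
  ultimately have "is_cycle T c" using k0 by (simp add: is_cycle_def len)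
  then show False using acyc by blast
qed

lemma childrenD:
  assumes "w \<in> children T r v"
  shows "w \<in> verts T" "(v, w) \<in> adj T" "level T r w = Suc (level T r v)"
  using assms by (auto simp: children_def)

lemma children_disjoint:
  assumes "rooted_tree T r" "u \<noteq> v"
  shows "children T r u \<inter> children T r v = {}"
proof (rule ccontr)
  assume "children T r u \<inter> children T r v \<noteq> {}"
  then obtain w where w: "w \<in> children T r u" "w \<in> children T r v" by blast
  have "level T r u = level T r v" using childrenD(3)[OF w(1)] childrenD(3)[OF w(2)] by simp
  then show False
    using parent_unique[OF assms(1) childrenD(2)[OF w(1)] _ childrenD(2)[OF w(2)]]
      childrenD(3)[OF w(2)] assms(2) by blast
qed

lemma card_level:
  assumes "infinite_binary_tree T r"
  shows "finite {v \<in> verts T. level T r v = n} \<and> card {v \<in> verts T. level T r v = n} = 2 ^ n"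
proof (induction n)
  case 0
  have "{v \<in> verts T. level T r v = 0} = {r}"
    using assms level_0_iff[of T r] by (auto simp: infinite_binary_tree_def rooted_tree_def level_root)
  then show ?case by simp
next
  case (Suc n)
  let ?L = "{v \<in> verts T. level T r v = n}"
  have T: "rooted_tree T r" and two: "\<And>v. v \<in> verts T \<Longrightarrow> card (children T r v) = 2"
    using assms by (auto simp: infinite_binary_tree_def)
  have fin: "finite (children T r v)" if "v \<in> ?L" for v
    using two[of v] that by (intro card_ge_0_finite) auto
  have eq: "{v \<in> verts T. level T r v = Suc n} = (\<Union>v\<in>?L. children T r v)"
    using parent_exists[of T r _ n] T by (fastforce simp: children_def rooted_tree_def)
  have "card (\<Union>v\<in>?L. children T r v) = (\<Sum>v\<in>?L. card (children T r v))"
    using Suc fin children_disjoint[OF T] by (intro card_UN_disjoint) auto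
  also have "\<dots> = (\<Sum>v\<in>?L. 2)" by (rule sum.cong) (auto simp: two)
  finally show ?case using Suc fin by (simp add: eq)
qed


section \<open>Finite binary trees inside an infinite one\<close>

text \<open>By induction on the level: a vertex with the same level in both trees has two children in the
  small tree, and these are among its two children in the large one, because a neighbour of lower or
  equal level would already have received its level in the small tree.\<close>

lemma binary_tree_of_depth_contains_levels:
  assumes T: "infinite_binary_tree T r" and sub: "subgraph S T" and S: "binary_tree_of_depth N S r"
    and "v \<in> verts T" "level T r v \<le> N"
  shows "v \<in> verts S \<and> level S r v = level T r v"
proof -
  have rT: "simple_graph T" "connected_graph T" "r \<in> verts T"
    using T by (auto simp: infinite_binary_tree_def rooted_tree_def)
  have rS: "connected_graph S" "r \<in> verts S"
    using S by (auto simp: binary_tree_of_depth_def rooted_tree_def)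
  have "\<forall>v\<in>verts T. level T r v \<le> n \<longrightarrow> v \<in> verts S \<and> level S r v = level T r v" if "n \<le> N" for n
    using that
  proof (induction n)
    case 0
    then show ?case using rS level_0_iff[OF rT(2,3)] by (auto simp: level_root)
  next
    case (Suc n)
    then have IH: "\<And>v. v \<in> verts T \<Longrightarrow> level T r v \<le> n \<Longrightarrow> v \<in> verts S \<and> level S r v = level T r v"
      by (meson Suc_leD)
    show ?case
    proof (intro ballI impI)
      fix w assume w: "w \<in> verts T" "level T r w \<le> Suc n"
      show "w \<in> verts S \<and> level S r w = level T r w"
      proof (cases "level T r w \<le> n")
        case True
        then show ?thesis using IH w by blast
      next
        case False
        then have lw: "level T r w = Suc n" using w by simp
        obtain v where v: "v \<in> verts T" "(v, w) \<in> adj T" "level T r v = n"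
          using parent_exists[OF rT w(1) lw] by blast
        have vS: "v \<in> verts S" "level S r v = n" using IH[OF v(1)] v(3) by auto
        have "children S r v \<subseteq> children T r v"
        proof
          fix y assume y: "y \<in> children S r v"
          have yT: "y \<in> verts T" "(v, y) \<in> adj T"
            using childrenD[OF y] sub by (auto simp: subgraph_def adj_iff)
          have "\<not> level T r y \<le> n" using IH[OF yT(1)] childrenD(3)[OF y] vS(2) by auto
          then show "y \<in> children T r v"
            using level_adj_le[OF rT(2,3) v(1) yT(2)] yT v(3) by (auto simp: children_def)
        qed
        moreover have "card (children S r v) = 2"
          using S vS Suc.prems by (simp add: binary_tree_of_depth_def)
        moreover have "card (children T r v) = 2"
          using T v(1) by (simp add: infinite_binary_tree_def)
        ultimately have "children S r v = children T r v"
          using card_subset_eq[OF card_ge_0_finite, of "children T r v" "children S r v"] by simp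
        moreover have "w \<in> children T r v" using w v lw by (simp add: children_def)
        ultimately have "w \<in> children S r v" by simp
        then show ?thesis using childrenD[of w S r v] vS lw by simp
      qed
    qed
  qed
  then show ?thesis using assms(4,5) by blast
qed

text \<open>Following parents leads from any vertex to the root through lower levels only, so cutting off the
  levels above \<open>N\<close> keeps the tree connected and changes no remaining level.\<close>

lemma binary_tree_of_depth_truncation:
  assumes T: "infinite_binary_tree T r"
  shows "binary_tree_of_depth N (induced T {v. level T r v \<le> N}) r"
proof -
  let ?S = "induced T {v. level T r v \<le> N}"
  have rT: "simple_graph T" "connected_graph T" "r \<in> verts T" and acyc: "\<nexists>c. is_cycle T c"
    and two: "\<And>v. v \<in> verts T \<Longrightarrow> card (children T r v) = 2"
    using T by (auto simp: infinite_binary_tree_def rooted_tree_def)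
  have vS: "v \<in> verts ?S \<longleftrightarrow> v \<in> verts T \<and> level T r v \<le> N" for v by (auto simp: induced_def)
  have eS: "(u, v) \<in> adj ?S \<longleftrightarrow> (u, v) \<in> adj T \<and> level T r u \<le> N \<and> level T r v \<le> N" for u v
    by (auto simp: induced_def adj_iff)
  have path: "(r, v) \<in> adj ?S ^^ n" if "v \<in> verts T" "level T r v = n" "n \<le> N" for v n
    using that
  proof (induction n arbitrary: v)
    case 0
    then show ?case using level_0_iff[OF rT(2,3)] by auto
  next
    case (Suc n)
    obtain u where u: "u \<in> verts T" "(u, v) \<in> adj T" "level T r u = n"
      using parent_exists[OF rT Suc.prems(1,2)] by blast
    have "(r, u) \<in> adj ?S ^^ n" using Suc.IH[OF u(1,3)] Suc.prems by simp
    moreover have "(u, v) \<in> adj ?S" using u Suc.prems by (simp add: eS)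
    ultimately show ?case by auto
  qed
  have simple: "simple_graph ?S"
    unfolding simple_graph_def
  proof
    fix e assume "e \<in> edges ?S"
    then have e: "e \<in> edges T" "e \<subseteq> {v. level T r v \<le> N}" by (auto simp: induced_def)
    then obtain u v where uv: "u \<in> verts T" "v \<in> verts T" "u \<noteq> v" "e = {u, v}"
      using rT(1) unfolding simple_graph_def by blast
    then have "u \<in> verts ?S" "v \<in> verts ?S" using e(2) by (simp_all add: vS)
    then show "\<exists>u\<in>verts ?S. \<exists>v\<in>verts ?S. u \<noteq> v \<and> e = {u, v}" using uv(3,4) by blast
  qed
  have from_root: "(r, v) \<in> (adj ?S)\<^sup>*" if "v \<in> verts ?S" for v
    using path[of v "level T r v"] that vS[of v] by (simp add: relpow_imp_rtrancl)
  have con: "connected_graph ?S"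
    unfolding connected_graph_def
  proof (intro conjI ballI)
    show "verts ?S \<noteq> {}" using vS[of r] rT(3) by (auto simp: level_root)
    fix u v assume "u \<in> verts ?S" "v \<in> verts ?S"
    then have r: "(r, u) \<in> (adj ?S)\<^sup>*" "(r, v) \<in> (adj ?S)\<^sup>*" by (auto intro: from_root)
    show "(u, v) \<in> (adj ?S)\<^sup>*"
      using symD[OF sym_rtrancl[OF sym_adj] r(1)] r(2) by (rule rtrancl_trans)
  qed
  have level: "level ?S r v = level T r v" if "v \<in> verts ?S" for v
  proof (rule antisym)
    show "level ?S r v \<le> level T r v" using path[of v] that by (intro level_le) (simp add: vS)
    have "(r, v) \<in> adj ?S ^^ level ?S r v"
      using relpow_level[OF con _ that] rT(3) by (simp add: vS level_root)
    moreover have "adj ?S ^^ m \<subseteq> adj T ^^ m" for m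
    proof (induction m)
      case (Suc m)
      have "adj ?S \<subseteq> adj T" by (auto simp: eS)
      with Suc show ?case by (simp add: relcomp_mono)
    qed simp
    ultimately show "level T r v \<le> level ?S r v" by (intro level_le) blast
  qed
  have child: "children ?S r v = children T r v" if "v \<in> verts ?S" "level T r v < N" for v
    using that by (auto simp: children_def vS eS level)
  have "\<nexists>c. is_cycle ?S c" using acyc by (auto simp: is_cycle_def induced_def)
  then have "rooted_tree ?S r" using simple con rT(3) by (simp add: rooted_tree_def vS level_root)
  moreover have "level ?S r v \<le> N \<and> (level ?S r v < N \<longrightarrow> card (children ?S r v) = 2)"
    if v: "v \<in> verts ?S" for v
    using level[OF v] child[OF v] two[of v] v vS[of v] by simp
  ultimately show ?thesis by (simp add: binary_tree_of_depth_def)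
qed


section \<open>Revealing one vertex\<close>

abbreviation bernoulli_product :: "'a set \<Rightarrow> real \<Rightarrow> ('a \<Rightarrow> bool) measure" where
  "bernoulli_product W p \<equiv> PiM W (\<lambda>_. measure_pmf (bernoulli_pmf p))"

lemma prob_space_bernoulli_product: "prob_space (bernoulli_product W p)"
  by (intro prob_space_PiM measure_pmf.prob_space_axioms)

lemma open_measurable:
  assumes "v \<in> W"
  shows "Measurable.pred (bernoulli_product W p) (\<lambda>\<omega>. \<omega> v)"
proof -
  have "(\<lambda>\<omega>. \<omega> v) \<in> bernoulli_product W p \<rightarrow>\<^sub>M measure_pmf (bernoulli_pmf p)"
    using assms by (rule measurable_component_singleton)
  then show ?thesis by (simp cong: measurable_cong_sets)
qed

text \<open>The product measure splits off the factor of \<open>v\<close>, on which \<open>Q\<close> does not depend. This is the only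
  form of independence used below.\<close>

lemma prob_vertex_state:
  assumes v: "v \<in> W" and Q: "Measurable.pred (bernoulli_product W p) Q"
    and indep: "\<And>\<omega> b. Q (fun_upd \<omega> v b) = Q \<omega>"
  shows "measure (bernoulli_product W p) {\<omega> \<in> space (bernoulli_product W p). \<omega> v = b \<and> Q \<omega>} =
    pmf (bernoulli_pmf p) b * measure (bernoulli_product W p) {\<omega> \<in> space (bernoulli_product W p). Q \<omega>}"
proof -
  let ?B = "measure_pmf (bernoulli_pmf p)"
  let ?M = "bernoulli_product W p"
  let ?R = "bernoulli_product (W - {v}) p"
  let ?f = "\<lambda>(x, X). X(v := x)"
  interpret R: prob_space ?R by (rule prob_space_bernoulli_product)
  have W: "insert v (W - {v}) = W" using v by auto
  have distr: "distr (?B \<Otimes>\<^sub>M ?R) ?M ?f = ?M"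
    using distr_pair_PiM_eq_PiM[of "W - {v}" "\<lambda>_. ?B" v]
    unfolding W by (simp add: measure_pmf.prob_space_axioms)
  have f: "?f \<in> ?B \<Otimes>\<^sub>M ?R \<rightarrow>\<^sub>M ?M"
    using measurable_fun_upd[of "W" "W - {v}" v snd "?B \<Otimes>\<^sub>M ?R" "\<lambda>_. ?B" fst] W
    by (simp add: case_prod_beta')
  have upd: "(\<lambda>X. X(v := True)) \<in> ?R \<rightarrow>\<^sub>M ?M"
    using measurable_fun_upd[of "W" "W - {v}" v "\<lambda>X. X" ?R "\<lambda>_. ?B" "\<lambda>_. True"] W by simp
  have QR: "{X \<in> space ?R. Q X} \<in> sets ?R"
    using measurable_compose[OF upd Q] by (simp add: indep pred_def)
  have split: "measure ?M {\<omega> \<in> space ?M. \<omega> v \<in> S \<and> Q \<omega>} =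
      measure ?B S * measure ?R {X \<in> space ?R. Q X}" for S
  proof -
    have S: "Measurable.pred ?M (\<lambda>\<omega>. \<omega> v \<in> S)"
      using measurable_compose[OF measurable_component_singleton[OF v], of "\<lambda>x. x \<in> S" "\<lambda>_. ?B"]
      by simp
    have "measure ?M {\<omega> \<in> space ?M. \<omega> v \<in> S \<and> Q \<omega>} =
        measure (distr (?B \<Otimes>\<^sub>M ?R) ?M ?f) {\<omega> \<in> space ?M. \<omega> v \<in> S \<and> Q \<omega>}"
      by (simp add: distr)
    also have "\<dots> = measure (?B \<Otimes>\<^sub>M ?R) (?f -` {\<omega> \<in> space ?M. \<omega> v \<in> S \<and> Q \<omega>} \<inter> space (?B \<Otimes>\<^sub>M ?R))"
      using S Q by (intro measure_distr f) simp
    also have "?f -` {\<omega> \<in> space ?M. \<omega> v \<in> S \<and> Q \<omega>} \<inter> space (?B \<Otimes>\<^sub>M ?R) = S \<times> {X \<in> space ?R. Q X}"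
      using measurable_space[OF f] by (auto simp: space_pair_measure indep)
    also have "measure (?B \<Otimes>\<^sub>M ?R) (S \<times> {X \<in> space ?R. Q X}) =
        measure ?B S * measure ?R {X \<in> space ?R. Q X}"
      using QR by (simp add: measure_def R.emeasure_pair_measure_Times enn2real_mult)
    finally show ?thesis .
  qed
  show ?thesis using split[of "{b}"] split[of UNIV] by (simp add: measure_pmf_single)
qed


section \<open>Open descending paths in a branching structure\<close>

text \<open>The number \<open>k\<close> counts the open vertices on a descending path from \<open>v\<close>. Height \<open>0\<close> demands
  nothing, so that the failure probabilities start at \<open>0\<close>.\<close>

primrec open_descent :: "('a \<Rightarrow> 'a set) \<Rightarrow> nat \<Rightarrow> 'a \<Rightarrow> ('a \<Rightarrow> bool) \<Rightarrow> bool" where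
  "open_descent ch 0 v \<omega> \<longleftrightarrow> True"
| "open_descent ch (Suc k) v \<omega> \<longleftrightarrow> \<omega> v \<and> (\<exists>w\<in>ch v. open_descent ch k w \<omega>)"

lemma open_descent_SucD: "open_descent ch (Suc k) v \<omega> \<Longrightarrow> open_descent ch k v \<omega>"
  by (induction k arbitrary: v) auto

lemma open_descent_antimono:
  assumes "open_descent ch l v \<omega>" "k \<le> l"
  shows "open_descent ch k v \<omega>"
  using assms(2,1)
  by (induction rule: dec_induct) (auto dest: open_descent_SucD simp del: open_descent.simps)

text \<open>The vertices in \<open>W\<close> are percolated; \<open>U\<close> carries a forest, possibly with infinitely many roots,
  whose vertices have two children each.\<close>

locale binary_branching =
  fixes W U :: "'a set" and ch :: "'a \<Rightarrow> 'a set" and lev :: "'a \<Rightarrow> nat" and p :: real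
  assumes U_subset: "U \<subseteq> W"
    and ch_subset: "v \<in> U \<Longrightarrow> ch v \<subseteq> U"
    and card_ch: "v \<in> U \<Longrightarrow> card (ch v) = 2"
    and lev_ch: "v \<in> U \<Longrightarrow> w \<in> ch v \<Longrightarrow> lev w = Suc (lev v)"
    and ch_disjoint: "u \<in> U \<Longrightarrow> v \<in> U \<Longrightarrow> u \<noteq> v \<Longrightarrow> ch u \<inter> ch v = {}"
    and p_bounds: "1/2 < p" "p \<le> 1"
begin

abbreviation "M \<equiv> bernoulli_product W p"

sublocale prob_space M
  by (rule prob_space_bernoulli_product)

abbreviation "q \<equiv> (1 - p) / p"

lemma q_fixed_point: "(1 - p) + p * q\<^sup>2 = q"
  using p_bounds by (simp add: field_simps power2_eq_square)

lemma q_bounds: "0 \<le> q" "q < 1"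
  using p_bounds by (auto simp: field_simps)

lemma finite_ch: "v \<in> U \<Longrightarrow> finite (ch v)"
  using card_ch by (intro card_ge_0_finite) auto

lemma open_descent_measurable:
  "v \<in> U \<Longrightarrow> Measurable.pred M (open_descent ch k v)"
proof (induction k arbitrary: v)
  case (Suc k)
  have "Measurable.pred M (\<lambda>\<omega>. \<exists>w\<in>ch v. open_descent ch k w \<omega>)"
    using Suc finite_ch ch_subset by (intro pred_intros_finite) blast+
  moreover have "Measurable.pred M (\<lambda>\<omega>. \<omega> v)" using Suc.prems U_subset by (intro open_measurable) auto
  ultimately show ?case by simp
next
  case 0
  have "open_descent ch 0 v = (\<lambda>_. True)" by auto
  then show ?case by simp
qed

text \<open>A descent only looks at its starting point and at strictly higher levels.\<close>

lemma open_descent_fun_upd: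
  "u \<in> U \<Longrightarrow> lev v \<le> lev u \<Longrightarrow> u \<noteq> v \<Longrightarrow>
    open_descent ch k u (fun_upd \<omega> v b) = open_descent ch k u \<omega>"
proof (induction k arbitrary: u)
  case (Suc k)
  have "open_descent ch k w (fun_upd \<omega> v b) = open_descent ch k w \<omega>" if "w \<in> ch u" for w
  proof -
    have "lev v < lev w" using lev_ch[OF Suc.prems(1) that] Suc.prems(2) by simp
    moreover have "w \<in> U" using ch_subset[OF Suc.prems(1)] that by auto
    ultimately show ?thesis by (intro Suc.IH) auto
  qed
  moreover have "fun_upd \<omega> v b u = \<omega> u" using Suc.prems by simp
  ultimately show ?case by (simp only: open_descent.simps cong: bex_cong)
qed simp

text \<open>The failure probability of one descent satisfies the recursion \<open>x \<mapsto> (1 - p) + p * x\<^sup>2\<close> in the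
  height and starts at \<open>0\<close>, hence never exceeds the fixed point \<open>q\<close>. The joint bound for a whole
  level comes from revealing the vertices of \<open>A\<close> one after another, where each open one is replaced by its two children, which are collected in a set \<open>B\<close> on the next level.
  A revealed vertex contributes \<open>(1 - p) + p * q\<^sup>2 = q\<close>, because its children are not yet in \<open>B\<close>.\<close>

lemma prob_all_descents_fail:
  assumes "finite A" "A \<subseteq> {v \<in> U. lev v = n}"
  shows "prob {\<omega> \<in> space M. \<forall>v\<in>A. \<not> open_descent ch k v \<omega>} \<le> q ^ card A"
  using assms
proof (induction k arbitrary: A n)
  case 0
  then show ?case using q_bounds by (cases "A = {}") (auto simp: prob_space)
next
  case (Suc k)
  let ?fail = "\<lambda>A B \<omega>. (\<forall>v\<in>A. \<not> open_descent ch (Suc k) v \<omega>) \<and> (\<forall>w\<in>B. \<not> open_descent ch k w \<omega>)"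
  have "prob {\<omega> \<in> space M. ?fail A B \<omega>} \<le> q ^ (card A + card B)"
    if "finite B" "B \<subseteq> {v \<in> U. lev v = Suc n}" "\<forall>v\<in>A. ch v \<inter> B = {}" for B
    using Suc.prems that
  proof (induction A arbitrary: B rule: finite_induct)
    case empty
    then show ?case using Suc.IH[of B "Suc n"] by simp
  next
    case (insert v A)
    have v: "v \<in> U" "lev v = n" using insert.prems by auto
    let ?B' = "B \<union> ch v"
    have B': "finite ?B'" "?B' \<subseteq> {v \<in> U. lev v = Suc n}" "\<forall>u\<in>A. ch u \<inter> ?B' = {}"
      using insert.prems insert.hyps finite_ch[OF v(1)] ch_subset[OF v(1)] lev_ch[OF v(1)] v(2)
        ch_disjoint[OF _ v(1)] by auto blast+
    have cardB': "card ?B' = card B + 2"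
      using insert.prems finite_ch[OF v(1)] card_ch[OF v(1)]
      by (subst card_Un_disjoint) auto
    have indep: "?fail A C (fun_upd \<omega> v b) = ?fail A C \<omega>" if C: "C \<subseteq> {v \<in> U. lev v = Suc n}" for C \<omega> b
    proof -
      have "open_descent ch (Suc k) u (fun_upd \<omega> v b) = open_descent ch (Suc k) u \<omega>" if "u \<in> A" for u
        using that insert.prems insert.hyps v by (intro open_descent_fun_upd) auto
      moreover have "open_descent ch k u (fun_upd \<omega> v b) = open_descent ch k u \<omega>" if "u \<in> C" for u
        using that C v by (intro open_descent_fun_upd) auto
      ultimately show ?thesis by simp
    qed
    have meas: "Measurable.pred M (?fail A C)" if "finite C" "C \<subseteq> {v \<in> U. lev v = Suc n}" for C
    proof -
      have "Measurable.pred M (\<lambda>\<omega>. \<forall>u\<in>A. \<not> open_descent ch (Suc k) u \<omega>)"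
        using insert.prems insert.hyps
        by (intro pred_intros_finite pred_intros_logic open_descent_measurable) auto
      moreover have "Measurable.pred M (\<lambda>\<omega>. \<forall>u\<in>C. \<not> open_descent ch k u \<omega>)"
        using that by (intro pred_intros_finite pred_intros_logic open_descent_measurable) auto
      ultimately show ?thesis by simp
    qed
    have vW: "v \<in> W" using v U_subset by auto
    have step: "prob {\<omega> \<in> space M. \<omega> v = b \<and> ?fail A C \<omega>} \<le>
        pmf (bernoulli_pmf p) b * q ^ (card A + card C)"
      if C: "finite C" "C \<subseteq> {v \<in> U. lev v = Suc n}" "\<forall>u\<in>A. ch u \<inter> C = {}" for b C
    proof -
      have "prob {\<omega> \<in> space M. ?fail A C \<omega>} \<le> q ^ (card A + card C)"
        using insert.prems C by (intro insert.IH) auto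
      then show ?thesis
        by (subst prob_vertex_state[OF vW meas[OF C(1,2)] indep[OF C(2)]])
          (intro mult_left_mono, auto)
    qed
    have sets: "{\<omega> \<in> space M. \<omega> v = b \<and> ?fail A C \<omega>} \<in> sets M"
      if "finite C" "C \<subseteq> {v \<in> U. lev v = Suc n}" for b C
    proof -
      have "Measurable.pred M (\<lambda>\<omega>. \<omega> v = b)" using open_measurable[OF vW, of p] by (cases b) auto
      from pred_intros_logic(3)[OF this meas[OF that]] show ?thesis unfolding pred_def .
    qed
    have "{\<omega> \<in> space M. ?fail (insert v A) B \<omega>} \<subseteq>
        {\<omega> \<in> space M. \<omega> v = False \<and> ?fail A B \<omega>} \<union> {\<omega> \<in> space M. \<omega> v = True \<and> ?fail A ?B' \<omega>}"
      by (auto simp del: bex_simps ball_simps)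
    then have "prob {\<omega> \<in> space M. ?fail (insert v A) B \<omega>} \<le>
        prob ({\<omega> \<in> space M. \<omega> v = False \<and> ?fail A B \<omega>} \<union>
          {\<omega> \<in> space M. \<omega> v = True \<and> ?fail A ?B' \<omega>})"
      by (rule finite_measure_mono) (intro sets.Un sets insert.prems B')
    also have "\<dots> \<le> prob {\<omega> \<in> space M. \<omega> v = False \<and> ?fail A B \<omega>} +
        prob {\<omega> \<in> space M. \<omega> v = True \<and> ?fail A ?B' \<omega>}"
      by (rule measure_Un_le) (intro sets insert.prems B')+
    also have "\<dots> \<le> pmf (bernoulli_pmf p) False * q ^ (card A + card B) +
        pmf (bernoulli_pmf p) True * q ^ (card A + card ?B')"
      using insert.prems B' by (intro add_mono step) auto
    also have "\<dots> = q ^ (card A + card B) * ((1 - p) + p * q\<^sup>2)"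
      using p_bounds by (simp add: cardB' power_add ring_distribs power2_eq_square
          del: times_divide_eq_left times_divide_eq_right)
    also have "\<dots> = q ^ (card (insert v A) + card B)"
      unfolding q_fixed_point using insert.hyps by simp
    finally show ?case .
  qed
  from this[of "{}"] show ?case by simp
qed

text \<open>The lower bound is the same for all heights, so it survives their decreasing intersection.\<close>

lemma prob_infinite_descent:
  assumes "finite A" "A \<subseteq> {v \<in> U. lev v = n}"
  shows "1 - q ^ card A \<le> prob {\<omega> \<in> space M. \<exists>v\<in>A. \<forall>k. open_descent ch k v \<omega>}"
proof -
  let ?E = "\<lambda>k. {\<omega> \<in> space M. \<exists>v\<in>A. open_descent ch k v \<omega>}"
  have meas: "?E k \<in> sets M" for k
  proof -
    have "Measurable.pred M (\<lambda>\<omega>. \<exists>v\<in>A. open_descent ch k v \<omega>)"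
      using assms by (intro pred_intros_finite open_descent_measurable) auto
    then show ?thesis by (simp add: pred_def)
  qed
  have dec: "decseq ?E"
    by (intro decseq_SucI) (auto dest: open_descent_SucD simp del: open_descent.simps)
  have "1 - q ^ card A \<le> prob (?E k)" for k
  proof -
    have "{\<omega> \<in> space M. \<forall>v\<in>A. \<not> open_descent ch k v \<omega>} = space M - ?E k" by auto
    then show ?thesis
      using prob_all_descents_fail[OF assms, of k] prob_compl[OF meas[of k]] by simp
  qed
  moreover have "(\<lambda>k. prob (?E k)) \<longlonglongrightarrow> prob (\<Inter>k. ?E k)"
    using meas dec by (intro finite_Lim_measure_decseq) auto
  ultimately have "1 - q ^ card A \<le> prob (\<Inter>k. ?E k)" by (intro LIMSEQ_le_const) auto
  \<comment> \<open>As \<open>A\<close> is finite, one vertex of it serves all heights at once.\<close>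
  also have "(\<Inter>k. ?E k) = {\<omega> \<in> space M. \<exists>v\<in>A. \<forall>k. open_descent ch k v \<omega>}"
  proof -
    have "\<exists>v\<in>A. \<forall>k. open_descent ch k v \<omega>" if all: "\<forall>k. \<exists>v\<in>A. open_descent ch k v \<omega>" for \<omega>
    proof (rule ccontr)
      assume "\<not> ?thesis"
      then obtain h where h: "\<And>v. v \<in> A \<Longrightarrow> \<not> open_descent ch (h v) v \<omega>" by metis
      obtain K where K: "\<forall>i\<in>h ` A. i \<le> K"
        using assms(1) finite_nat_set_iff_bounded_le by blast
      obtain v where "v \<in> A" "open_descent ch K v \<omega>" using all by blast
      then show False using open_descent_antimono[of ch K v \<omega> "h v"] K h by auto
    qed
    then show ?thesis by auto
  qed
  finally show ?thesis .
qed

end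


section \<open>Infinite open clusters\<close>

text \<open>The plane is a countable union of compact discs, each of which contains finitely many vertices.\<close>

lemma countable_verts:
  assumes "properly_embedded G pos \<gamma>"
  shows "countable (verts G)"
proof -
  have "finite {v \<in> verts G. pos v \<in> cball 0 (real n)}" for n
    using assms compact_cball by (auto simp only: properly_embedded_def)
  then have "countable (\<Union>n::nat. {v \<in> verts G. pos v \<in> cball 0 (real n)})"
    by (intro countable_UN[OF countableI_type] countable_finite)
  moreover have "verts G \<subseteq> (\<Union>n::nat. {v \<in> verts G. pos v \<in> cball 0 (real n)})"
    by (auto simp: real_arch_simple)
  ultimately show ?thesis by (rule countable_subset[rotated])
qed

definition open_cluster :: "'a ugraph \<Rightarrow> ('a \<Rightarrow> bool) \<Rightarrow> 'a \<Rightarrow> 'a set" where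
  "open_cluster G \<omega> v = {w \<in> verts G. \<omega> w \<and> (v, w) \<in> (adj (induced G {v. \<omega> v}))\<^sup>*}"

text \<open>Naming a cluster by a vertex of \<open>S\<close> replaces the quantifier over sets of vertices by one over
  a countable set, which measurability requires.\<close>

lemma meets_infinite_cluster_iff:
  "\<omega> \<in> meets_infinite_cluster G S \<longleftrightarrow>
    (\<exists>v\<in>verts S \<inter> verts G. \<omega> v \<and> infinite (open_cluster G \<omega> v))"
proof -
  let ?H = "induced G {v. \<omega> v}"
  have vH: "v \<in> verts ?H \<longleftrightarrow> v \<in> verts G \<and> \<omega> v" for v by (auto simp: induced_def)
  have comp: "open_cluster G \<omega> v = {w \<in> verts ?H. (v, w) \<in> (adj ?H)\<^sup>*}" for v
    by (auto simp: open_cluster_def vH)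
  have same: "open_cluster G \<omega> u = open_cluster G \<omega> v" if "v \<in> open_cluster G \<omega> u" for u v
  proof -
    have uv: "(u, v) \<in> (adj ?H)\<^sup>*" using that by (simp add: comp)
    have vu: "(v, u) \<in> (adj ?H)\<^sup>*" by (rule symD[OF sym_rtrancl[OF sym_adj] uv])
    show ?thesis unfolding comp using rtrancl_trans[OF uv] rtrancl_trans[OF vu] by blast
  qed
  have "\<omega> \<in> meets_infinite_cluster G S \<longleftrightarrow>
      (\<exists>u\<in>verts ?H. infinite (open_cluster G \<omega> u) \<and> verts S \<inter> open_cluster G \<omega> u \<noteq> {})"
    by (auto simp: meets_infinite_cluster_def open_clusters_def components_def comp)
  also have "\<dots> \<longleftrightarrow> (\<exists>v\<in>verts S \<inter> verts G. \<omega> v \<and> infinite (open_cluster G \<omega> v))"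
  proof
    assume "\<exists>u\<in>verts ?H. infinite (open_cluster G \<omega> u) \<and> verts S \<inter> open_cluster G \<omega> u \<noteq> {}"
    then obtain u v where "infinite (open_cluster G \<omega> u)" "v \<in> verts S" "v \<in> open_cluster G \<omega> u"
      by blast
    then show "\<exists>v\<in>verts S \<inter> verts G. \<omega> v \<and> infinite (open_cluster G \<omega> v)"
      using same[of v u] by (auto simp: open_cluster_def)
  next
    assume "\<exists>v\<in>verts S \<inter> verts G. \<omega> v \<and> infinite (open_cluster G \<omega> v)"
    then obtain v where v: "v \<in> verts S" "v \<in> verts G" "\<omega> v" "infinite (open_cluster G \<omega> v)"
      by blast
    moreover have "v \<in> open_cluster G \<omega> v" using v by (simp add: open_cluster_def)
    ultimately show "\<exists>u\<in>verts ?H. infinite (open_cluster G \<omega> u) \<and> verts S \<inter> open_cluster G \<omega> u \<noteq> {}"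
      using vH by blast
  qed
  finally show ?thesis .
qed

lemma pred_bounded_countable:
  assumes "countable I" "\<And>i. i \<in> I \<Longrightarrow> Measurable.pred M (\<lambda>x. P x i)"
  shows "Measurable.pred M (\<lambda>x. \<forall>i\<in>I. P x i)" "Measurable.pred M (\<lambda>x. \<exists>i\<in>I. P x i)"
  using assms
  by (auto intro: sets.sets_Collect_countable_All' sets.sets_Collect_countable_Ex' simp: pred_def)

lemma open_path_measurable:
  assumes "simple_graph G" "countable (verts G)" "u \<in> verts G" "w \<in> verts G"
  shows "Measurable.pred (bernoulli_product (verts G) p)
    (\<lambda>\<omega>. (u, w) \<in> adj (induced G {v. \<omega> v}) ^^ n)"
  using assms(4)
proof (induction n arbitrary: w)
  case (Suc n)
  let ?M = "bernoulli_product (verts G) p"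
  have edge: "(y, w) \<in> adj (induced G {v. \<omega> v}) \<longleftrightarrow> {y, w} \<in> edges G \<and> \<omega> y \<and> \<omega> w" for y \<omega>
    by (auto simp: adj_iff induced_def)
  have eq: "(u, w) \<in> adj (induced G {v. \<omega> v}) ^^ Suc n \<longleftrightarrow>
      (\<exists>y\<in>verts G. (u, y) \<in> adj (induced G {v. \<omega> v}) ^^ n \<and> {y, w} \<in> edges G \<and> \<omega> y \<and> \<omega> w)" for \<omega>
    using adj_verts[OF assms(1)] edge by (auto simp: adj_iff relcomp_unfold)
  have "Measurable.pred ?M (\<lambda>\<omega>. \<exists>y\<in>verts G. (u, y) \<in> adj (induced G {v. \<omega> v}) ^^ n \<and>
      {y, w} \<in> edges G \<and> \<omega> y \<and> \<omega> w)"
    using Suc assms(2)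
    by (intro pred_bounded_countable pred_intros_logic open_measurable) auto
  then show ?case unfolding eq .
qed simp

text \<open>A cluster is infinite if it leaves every finite set of vertices, and of these there are only
  countably many.\<close>

lemma infinite_cluster_measurable:
  assumes "simple_graph G" "countable (verts G)" "v \<in> verts G"
  shows "Measurable.pred (bernoulli_product (verts G) p) (\<lambda>\<omega>. infinite (open_cluster G \<omega> v))"
proof -
  let ?F = "{F. finite F \<and> F \<subseteq> verts G}"
  have eq: "infinite (open_cluster G \<omega> v) \<longleftrightarrow>
      (\<forall>F\<in>?F. \<exists>w\<in>verts G - F. \<omega> w \<and> (\<exists>n. (v, w) \<in> adj (induced G {v. \<omega> v}) ^^ n))" for \<omega>
  proof -
    have "infinite (open_cluster G \<omega> v) \<longleftrightarrow> (\<forall>F\<in>?F. \<not> open_cluster G \<omega> v \<subseteq> F)"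
    proof
      assume "infinite (open_cluster G \<omega> v)"
      then show "\<forall>F\<in>?F. \<not> open_cluster G \<omega> v \<subseteq> F" using finite_subset by blast
    next
      assume "\<forall>F\<in>?F. \<not> open_cluster G \<omega> v \<subseteq> F"
      then show "infinite (open_cluster G \<omega> v)" by (auto simp: open_cluster_def)
    qed
    also have "\<dots> \<longleftrightarrow> (\<forall>F\<in>?F. \<exists>w\<in>verts G - F. \<omega> w \<and> (\<exists>n. (v, w) \<in> adj (induced G {v. \<omega> v}) ^^ n))"
      by (simp add: open_cluster_def rtrancl_power subset_eq Bex_def) blast
    finally show ?thesis .
  qed
  show ?thesis unfolding eq
    using assms countable_Collect_finite_subset[OF assms(2)]
    by (intro pred_bounded_countable pred_intros_logic pred_intros_countable
        open_measurable open_path_measurable) auto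
qed

lemma meets_infinite_cluster_measurable:
  assumes "simple_graph G" "countable (verts G)"
  shows "space (percolation G p) \<inter> meets_infinite_cluster G S \<in> sets (percolation G p)"
proof -
  let ?M = "bernoulli_product (verts G) p"
  have "Measurable.pred ?M (\<lambda>\<omega>. \<exists>v\<in>verts S \<inter> verts G. \<omega> v \<and> infinite (open_cluster G \<omega> v))"
    using assms
    by (intro pred_bounded_countable pred_intros_logic open_measurable
        infinite_cluster_measurable) auto
  moreover have "space ?M \<inter> meets_infinite_cluster G S =
      {\<omega> \<in> space ?M. \<exists>v\<in>verts S \<inter> verts G. \<omega> v \<and> infinite (open_cluster G \<omega> v)}"
    by (auto simp: meets_infinite_cluster_iff)
  ultimately show ?thesis by (simp add: percolation_def pred_def)
qed

lemma open_descent_reaches_level: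
  assumes "subgraph T G" "v \<in> verts T" "open_descent (children T r) (Suc k) v \<omega>"
  shows "\<exists>w\<in>open_cluster G \<omega> v. level T r w = level T r v + k"
  using assms(2,3)
proof (induction k arbitrary: v)
  case 0
  then show ?case using assms(1) by (auto simp: open_cluster_def subgraph_def)
next
  case (Suc k)
  then obtain y where y: "\<omega> v" "y \<in> children T r v" "open_descent (children T r) (Suc k) y \<omega>"
    by auto
  have "\<omega> y" using y(3) by simp
  then have vy: "(v, y) \<in> adj (induced G {v. \<omega> v})"
    using childrenD(2)[OF y(2)] y(1) assms(1) by (auto simp: adj_iff induced_def subgraph_def)
  obtain w where "w \<in> open_cluster G \<omega> y" "level T r w = level T r y + k"
    using Suc.IH[OF childrenD(1)[OF y(2)] y(3)] by blast
  then show ?case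
    using vy childrenD(3)[OF y(2)]
    by (intro bexI[of _ w]) (auto simp: open_cluster_def intro: converse_rtrancl_into_rtrancl)
qed

text \<open>The cluster contains vertices of arbitrarily high level.\<close>

lemma infinite_descent_imp_infinite_cluster:
  assumes "subgraph T G" "v \<in> verts T" "\<forall>k. open_descent (children T r) k v \<omega>"
  shows "infinite (open_cluster G \<omega> v)"
proof
  assume "finite (open_cluster G \<omega> v)"
  then obtain K where K: "\<forall>l\<in>level T r ` open_cluster G \<omega> v. l \<le> K"
    using finite_nat_set_iff_bounded_le by blast
  obtain w where "w \<in> open_cluster G \<omega> v" "level T r w = level T r v + Suc K"
    using open_descent_reaches_level[OF assms(1,2), of r "Suc K" \<omega>] assms(3) by blast
  then show False using K by fastforce
qed

lemma prob_meets_infinite_cluster_ge: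
  assumes G: "simple_graph G" "countable (verts G)" and sub: "subgraph T G"
    and T: "infinite_binary_tree T x" and p: "1/2 < p" "p \<le> 1"
    and S: "subgraph S T" "binary_tree_of_depth N S x"
  shows "1 - ((1 - p) / p) ^ (2 ^ N) \<le>
    measure (percolation G p) (space (percolation G p) \<inter> meets_infinite_cluster G S)"
proof -
  interpret binary_branching "verts G" "verts T" "children T x" "level T x" p
  proof
    show "verts T \<subseteq> verts G" using sub by (simp add: subgraph_def)
  next
    fix v assume "v \<in> verts T"
    then show "card (children T x v) = 2" using T by (simp add: infinite_binary_tree_def)
  next
    fix u v :: 'a assume "u \<noteq> v"
    then show "children T x u \<inter> children T x v = {}"
      using T by (intro children_disjoint) (simp_all add: infinite_binary_tree_def)
  qed (use p in \<open>auto simp: children_def\<close>)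
  let ?A = "{v \<in> verts T. level T x v = N}"
  have "1 - ((1 - p) / p) ^ (2 ^ N) \<le>
      prob {\<omega> \<in> space M. \<exists>v\<in>?A. \<forall>k. open_descent (children T x) k v \<omega>}"
    using prob_infinite_descent[of ?A N] card_level[OF T, of N] by simp
  also have "\<dots> \<le> prob (space M \<inter> meets_infinite_cluster G S)"
  proof (rule finite_measure_mono)
    show "space M \<inter> meets_infinite_cluster G S \<in> sets M"
      using meets_infinite_cluster_measurable[OF G] by (simp add: percolation_def)
    have "\<omega> \<in> meets_infinite_cluster G S"
      if v: "v \<in> ?A" and desc: "\<forall>k. open_descent (children T x) k v \<omega>" for v \<omega>
    proof -
      have "v \<in> verts S" using binary_tree_of_depth_contains_levels[OF T S, of v] v by simp
      moreover have "v \<in> verts G" using v sub by (auto simp: subgraph_def)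
      moreover have "\<omega> v" using spec[OF desc, of "Suc 0"] by simp
      ultimately show ?thesis
        using infinite_descent_imp_infinite_cluster[OF sub _ desc] v
        by (auto simp: meets_infinite_cluster_iff)
    qed
    then show "{\<omega> \<in> space M. \<exists>v\<in>?A. \<forall>k. open_descent (children T x) k v \<omega>}
        \<subseteq> space M \<inter> meets_infinite_cluster G S" by blast
  qed
  finally show ?thesis by (simp add: percolation_def)
qed

theorem lemma8p1:
  fixes G :: "'a ugraph" and pos :: "'a \<Rightarrow> real^2" and \<gamma> :: "'a set \<Rightarrow> real \<Rightarrow> real^2"
    and T :: "'a \<Rightarrow> 'a ugraph" and p :: real
  assumes "simple_graph G" and "connected_graph G" and "infinite (verts G)"
    and "properly_embedded G pos \<gamma>"
    and "\<forall>v\<in>verts G. 7 \<le> degree G v"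
    and "\<forall>x\<in>verts G. subgraph (T x) G \<and> infinite_binary_tree (T x) x"
    and "1/2 < p" and "p \<le> 1"
  shows "(\<lambda>N. INF x\<in>verts G. INF S\<in>{S. subgraph S (T x) \<and> binary_tree_of_depth N S x}.
            measure (percolation G p) (space (percolation G p) \<inter> meets_infinite_cluster G S))
         \<longlonglongrightarrow> 1"
proof -
  let ?P = "\<lambda>S. measure (percolation G p) (space (percolation G p) \<inter> meets_infinite_cluster G S)"
  let ?trees = "\<lambda>N x. {S. subgraph S (T x) \<and> binary_tree_of_depth N S x}"
  let ?q = "(1 - p) / p"
  have countable: "countable (verts G)" using assms(4) by (rule countable_verts)
  have T: "subgraph (T x) G" "infinite_binary_tree (T x) x" if "x \<in> verts G" for x
    using assms(6) that by auto
  obtain x0 where x0: "x0 \<in> verts G" using assms(3) finite.emptyI by (metis ex_in_conv)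
  have nonempty: "?trees N x \<noteq> {}" if "x \<in> verts G" for N x
  proof -
    have "subgraph (induced (T x) {v. level (T x) x v \<le> N}) (T x)"
      by (auto simp: subgraph_def induced_def)
    then show ?thesis using binary_tree_of_depth_truncation[OF T(2)[OF that], of N] by blast
  qed
  have P_le_1: "?P S \<le> 1" for S
    using prob_space.prob_le_1[OF prob_space_bernoulli_product] by (simp add: percolation_def)
  have tree_lower: "1 - ?q ^ (2 ^ N) \<le> (INF S\<in>?trees N x. ?P S)" if "x \<in> verts G" for N x
  proof (rule cINF_greatest[OF nonempty[OF that]])
    fix S assume "S \<in> ?trees N x"
    then show "1 - ?q ^ (2 ^ N) \<le> ?P S"
      using prob_meets_infinite_cluster_ge[OF assms(1) countable T[OF that] assms(7,8)] by blast
  qed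
  have tree_upper: "(INF S\<in>?trees N x. ?P S) \<le> 1" if "x \<in> verts G" for N x
  proof -
    obtain S where "S \<in> ?trees N x" using nonempty[OF \<open>x \<in> verts G\<close>] by blast
    then have "(INF S\<in>?trees N x. ?P S) \<le> ?P S"
      by (rule cINF_lower[OF bdd_belowI2[OF measure_nonneg]])
    then show ?thesis using P_le_1[of S] by linarith
  qed
  have lower: "1 - ?q ^ (2 ^ N) \<le> (INF x\<in>verts G. INF S\<in>?trees N x. ?P S)" for N
  proof (rule cINF_greatest)
    show "verts G \<noteq> {}" using x0 by blast
  qed (rule tree_lower)
  have upper: "(INF x\<in>verts G. INF S\<in>?trees N x. ?P S) \<le> 1" for N
  proof -
    have "bdd_below ((\<lambda>x. INF S\<in>?trees N x. ?P S) ` verts G)"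
      by (rule bdd_belowI2[where m = "1 - ?q ^ (2 ^ N)"]) (rule tree_lower)
    then have "(INF x\<in>verts G. INF S\<in>?trees N x. ?P S) \<le> (INF S\<in>?trees N x0. ?P S)"
      using x0 by (rule cINF_lower)
    then show ?thesis using tree_upper[OF x0] by (rule order_trans)
  qed
  have q: "0 \<le> ?q" "?q < 1" using assms(7,8) by (auto simp: field_simps)
  have "(\<lambda>N. ?q ^ (2 ^ N)) \<longlonglongrightarrow> 0"
    using LIMSEQ_subseq_LIMSEQ[OF LIMSEQ_realpow_zero[OF q], of "\<lambda>N. 2 ^ N"]
    by (simp add: strict_mono_def o_def)
  then have lim: "(\<lambda>N. 1 - ?q ^ (2 ^ N)) \<longlonglongrightarrow> 1"
    using tendsto_diff[OF tendsto_const, of _ 0 sequentially "1::real"] by simp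
  show ?thesis
    by (rule tendsto_sandwich[OF always_eventually always_eventually lim tendsto_const])
      (use lower upper in blast)+
qed

end
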